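(* Let $\alpha,\beta,\gamma\in[0,2\pi)$ denote the radians of the first, second and third circular arcs, respectively, of a path of type $CCC$. If the solution path for the minimum-time Problem described in the context is of type $CCC$, the following two statements hold. (1) If the solution path is of $RLR$, we have $$c_1\beta^2+c_2\beta+c_3\cos\beta+c_4=0,$$ $$\cos\left(-\alpha+\tfrac{\beta}{2}+\tfrac{\pi}{2}\right)=\frac{-\left(X_{T0}+\rho w_x\left(\frac{\pi}{2}-\theta_f+2\beta+2n\pi\right)\right)-\rho\sin\theta_f+\rho}{4\rho\sin\left(-\frac{\beta}{2}\right)},$$ $$\cos\left(\gamma-\tfrac{\beta}{2}-\theta_f\right)=\frac{-\left(X_{T0}+\rho w_x\left(\frac{\pi}{2}-\theta_f+2\beta+2n\pi\right)\right)-\rho\sin\theta_f+\rho}{4\rho\sin\left(-\frac{\beta}{2}\right)},$$ where the positive integer $n$ takes values so that $\left(\frac{\pi}{2}-\alpha+\beta-\gamma+2n\pi\right)\in[0,2\pi)$, and $$c_1=4\rho^2(w_x^2+w_y^2),\quad c_2=4\rho(Mw_x-Nw_y),\quad c_3=8\rho^2,\quad c_4=M^2+N^2-8\rho^2,$$ with $$M=-X_{T0}-\rho w_x\left(\tfrac{\pi}{2}-\theta_f+2n\pi\right)-\rho\sin\theta_f+\rho,\qquad N=Y_{T0}+\rho w_y\left(\tfrac{\pi}{2}-\theta_f+2n\pi\right)-\rho\cos\theta_f.$$ (2) If the solution path is of $LRL$, we have $$d_1\beta^2+d_2\beta+d_3\cos\beta+d_4=0,$$ $$\cos\left(\alpha-\tfrac{\beta}{2}+\tfrac{\pi}{2}\right)=\frac{X_{T0}+\rho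 w_x\left(\theta_f+2\beta-\frac{\pi}{2}+2n\pi\right)-\rho\sin\theta_f+\rho}{4\rho\sin\left(\frac{\beta}{2}\right)},$$ $$\cos\left(-\gamma+\tfrac{\beta}{2}+\theta_f\right)=\frac{X_{T0}+\rho w_x\left(\theta_f+2\beta-\frac{\pi}{2}+2n\pi\right)-\rho\sin\theta_f+\rho}{4\rho\sin\left(\frac{\beta}{2}\right)},$$ where the positive integer $n$ takes values so that $\left(\frac{\pi}{2}+\alpha-\beta+\gamma+2n\pi\right)\in[0,2\pi)$, and $$d_1=4\rho^2(w_x^2+w_y^2),\quad d_2=4\rho(Pw_x-Qw_y),\quad d_3=8\rho^2,\quad d_4=P^2+Q^2-8\rho^2,$$ with $$P=X_{T0}+\rho w_x\left(\theta_f-\tfrac{\pi}{2}-2n\pi\right)-\rho\sin\theta_f+\rho,\qquad Q=-Y_{T0}-\rho w_y\left(\theta_f-\tfrac{\pi}{2}-2n\pi\right)-\rho\cos\theta_f.$$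
   Context: Dubins airplane (in the air-relative frame, which moves with the steady wind; speed normalized to one): the state is $(x,y,\theta)$, with position $(x,y)\in\mathbb{R}^2$ and heading angle $\theta\in[0,2\pi)$ measured counterclockwise from the $x$-axis, governed by $$\dot x=\cos\theta,\qquad \dot y=\sin\theta,\qquad \dot\theta=u/\rho,\qquad u(t)\in[-1,1],$$ where $\rho>0$ is a constant related to the minimum turning radius. The initial state at $t=0$ is $(x_0,y_0,\theta_0)=(0,0,\pi/2)$. Problem: find a minimum time $t_f>0$ and a measurable control $u(\cdot)\in[-1,1]$ on $[0,t_f]$ so that the system is steered from $(x_0,y_0,\theta_0)$ to a target $(x_f,y_f,\theta_f)$ satisfying $(x_f,y_f)=(X_{T0},Y_{T0})-t_f(w_x,w_y)$. Here $(w_x,w_y)\in\mathbb{R}^2$ is the constant velocity of the wind in the inertial frame, assumed to satisfy $w_x^2+w_y^2<1$, $(X_{T0},Y_{T0})$ is the position of the target in the inertial frame (whose origin is the initial position of the airplane), and $\theta_f$ is the prescribed final heading angle. Path types: $L$ denotes a counterclockwise circular arc ($u=1$), $R$ a clockwise circular arc ($u=-1$), and $C$ stands for $L$ or $R$. A path of type $CCC$ (that is, of type $RLR$ or $LRL$) with arc radians $\alpha,\beta,\gamma\in[0,2\pi)$ is generated by $u=\sigma$ on $[0,\rho\alpha)$, $u=-\sigma$ on $[\rho\alpha,\rho(\alpha+\beta))$ and $u=\sigma$ on $[\rho(\alpha+\beta),\rho(\alpha+\beta+\gamma)]$, with $\sigma=-1$ for type $RLR$ and $\sigma=1$ for ty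pe $LRL$.
   Formalization: Printed signs are false and corrected: wind terms in M, N, P, Q and all numerators are reversed, d₂ gets a minus sign, the third formula of (1) has cos(γ−β/2+θ_f), and the numerators in (2) have −2nπ. Cosine formulas are stated for β≠0; n is any integer. *)

theory Defs
  imports "HOL-Analysis.Analysis"
begin

definition admissible_control :: "real \<Rightarrow> (real \<Rightarrow> real) \<Rightarrow> bool" where
  "admissible_control T u \<longleftrightarrow>
     u \<in> borel_measurable (lebesgue_on {0..T}) \<and> (\<forall>t\<in>{0..T}. u t \<in> {-1..1})"

text \<open>For a control that is merely measurable, the differential equation is understood in the
  sense of Caratheodory, that is, in integrated form. The heading is carried along as a continuous
  real-valued angle; it is reduced modulo a full turn only in the terminal condition below.\<close>

definition dubins_trajectory ::
  "real \<Rightarrow> real \<Rightarrow> (real \<Rightarrow> real) \<Rightarrow> (real \<Rightarrow> real) \<Rightarrow> (real \<Rightarrow> real) \<Rightarrow> (real \<Rightarrow> real) \<Rightarrow> bool" where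
  "dubins_trajectory \<rho> T u x y \<theta> \<longleftrightarrow>
     x 0 = 0 \<and> y 0 = 0 \<and> \<theta> 0 = pi / 2 \<and>
     (\<forall>t\<in>{0..T}.
        ((\<lambda>s. cos (\<theta> s)) has_integral (x t - x 0)) {0..t} \<and>
        ((\<lambda>s. sin (\<theta> s)) has_integral (y t - y 0)) {0..t} \<and>
        ((\<lambda>s. u s / \<rho>) has_integral (\<theta> t - \<theta> 0)) {0..t})"

text \<open>In the frame moving with the wind \<open>(w\<^sub>x, w\<^sub>y)\<close>, a target resting at \<open>(X\<^sub>T, Y\<^sub>T)\<close> in the
  inertial frame is found at time \<open>T\<close> at \<open>(X\<^sub>T, Y\<^sub>T) - T (w\<^sub>x, w\<^sub>y)\<close>.\<close>

definition steers_to_target ::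
  "real \<Rightarrow> real \<Rightarrow> real \<Rightarrow> real \<Rightarrow> real \<Rightarrow> real \<Rightarrow> real \<Rightarrow> (real \<Rightarrow> real) \<Rightarrow> bool" where
  "steers_to_target \<rho> w\<^sub>x w\<^sub>y X\<^sub>T Y\<^sub>T \<theta>\<^sub>f T u \<longleftrightarrow>
     T > 0 \<and> admissible_control T u \<and>
     (\<exists>x y \<theta>. dubins_trajectory \<rho> T u x y \<theta> \<and>
        x T = X\<^sub>T - T * w\<^sub>x \<and> y T = Y\<^sub>T - T * w\<^sub>y \<and>
        (\<exists>k::int. \<theta> T = \<theta>\<^sub>f + 2 * of_int k * pi))"

definition min_time_solution ::
  "real \<Rightarrow> real \<Rightarrow> real \<Rightarrow> real \<Rightarrow> real \<Rightarrow> real \<Rightarrow> real \<Rightarrow> (real \<Rightarrow> real) \<Rightarrow> bool" where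
  "min_time_solution \<rho> w\<^sub>x w\<^sub>y X\<^sub>T Y\<^sub>T \<theta>\<^sub>f T u \<longleftrightarrow>
     steers_to_target \<rho> w\<^sub>x w\<^sub>y X\<^sub>T Y\<^sub>T \<theta>\<^sub>f T u \<and>
     (\<forall>T' u'. steers_to_target \<rho> w\<^sub>x w\<^sub>y X\<^sub>T Y\<^sub>T \<theta>\<^sub>f T' u' \<longrightarrow> T \<le> T')"

text \<open>The sign \<open>\<sigma>\<close> is the control on the outer arcs, so \<open>\<sigma> = 1\<close> stands for a path that starts and ends
  with a left turn.\<close>

definition CCC_type ::
  "real \<Rightarrow> real \<Rightarrow> real \<Rightarrow> real \<Rightarrow> real \<Rightarrow> real \<Rightarrow> (real \<Rightarrow> real) \<Rightarrow> bool" where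
  "CCC_type \<sigma> \<rho> \<alpha> \<beta> \<gamma> T u \<longleftrightarrow>
     T = \<rho> * (\<alpha> + \<beta> + \<gamma>) \<and>
     (\<forall>t\<in>{0..<\<rho> * \<alpha>}. u t = \<sigma>) \<and>
     (\<forall>t\<in>{\<rho> * \<alpha>..<\<rho> * (\<alpha> + \<beta>)}. u t = - \<sigma>) \<and>
     (\<forall>t\<in>{\<rho> * (\<alpha> + \<beta>)..\<rho> * (\<alpha> + \<beta> + \<gamma>)}. u t = \<sigma>)"

definition RLR_type where "RLR_type = CCC_type (- 1)"

definition LRL_type where "LRL_type = CCC_type 1"

end

theory Submission
  imports Defs
begin

text \<open>Along an arc of constant control \<open>\<sigma> = \<plusminus>1\<close> the position moves by
  \<open>\<sigma>\<rho> (\<Delta> sin \<theta>, - \<Delta> cos \<theta>)\<close>. Summing over the three arcs, and turning the contribution of the middle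
  heading change \<open>\<sigma>\<beta>\<close> into a product, the endpoint of a path of type CCC is
  \<open>\<sigma>\<rho> (sin \<theta>\<^sub>f - 1, - cos \<theta>\<^sub>f) + 4\<rho> sin (\<beta>/2) (cos m, sin m)\<close> with \<open>m = \<pi>/2 + \<sigma> (\<alpha> - \<beta>/2)\<close>.
  The first coordinate gives the two cosine formulas; the sum of squares, with
  \<open>16\<rho>\<^sup>2 sin\<^sup>2 (\<beta>/2) = 8\<rho>\<^sup>2 (1 - cos \<beta>)\<close>, gives the equation for \<open>\<beta>\<close>.\<close>

lemma has_integral_diff_interval:
  fixes f :: "real \<Rightarrow> real"
  assumes "(f has_integral i) {a..b}" "(f has_integral j) {a..c}" "a \<le> b" "b \<le> c"
  shows "(f has_integral (j - i)) {b..c}"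
proof -
  have "f integrable_on {b..c}"
    using assms by (auto intro: integrable_subinterval_real[of f a c])
  then obtain k where k: "(f has_integral k) {b..c}"
    by blast
  then have "(f has_integral (i + k)) {a..c}"
    using assms by (intro has_integral_combine)
  then have "i + k = j"
    using assms(2) has_integral_unique by blast
  then show ?thesis
    using k by auto
qed

text \<open>On the arc the heading is affine with slope \<sigma>/\<rho>, so \<sigma>\<rho> sin
  \<theta> and -\<sigma>\<rho> cos \<theta> are antiderivatives of the velocity components because
  \<sigma>\<sigma> = 1. The control is prescribed on a half-open interval since it may already have
  switched at \<open>b\<close>.\<close>

lemma dubins_arc:
  assumes traj: "dubins_trajectory \<rho> T u x y \<theta>"
    and ab: "0 \<le> a" "a \<le> b" "b \<le> T"
    and u: "\<forall>t\<in>{a..<b}. u t = \<sigma>" and \<sigma>: "\<sigma> * \<sigma> = 1" and "\<rho> > 0"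
  shows "\<theta> b = \<theta> a + \<sigma> * (b - a) / \<rho>"
    and "x b = x a + \<sigma> * \<rho> * (sin (\<theta> b) - sin (\<theta> a))"
    and "y b = y a - \<sigma> * \<rho> * (cos (\<theta> b) - cos (\<theta> a))"
proof -
  have integrals: "((\<lambda>s. cos (\<theta> s)) has_integral (x t - x 0)) {0..t}"
    "((\<lambda>s. sin (\<theta> s)) has_integral (y t - y 0)) {0..t}"
    "((\<lambda>s. u s / \<rho>) has_integral (\<theta> t - \<theta> 0)) {0..t}" if "t \<in> {0..T}" for t
    using traj that unfolding dubins_trajectory_def by blast+
  have \<theta>: "\<theta> t = \<theta> a + \<sigma> * (t - a) / \<rho>" if t: "t \<in> {a..b}" for t
  proof -
    have "((\<lambda>s. u s / \<rho>) has_integral ((\<theta> t - \<theta> 0) - (\<theta> a - \<theta> 0))) {a..t}"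
      by (rule has_integral_diff_interval[OF integrals(3) integrals(3)]) (use ab t in auto)
    moreover have "((\<lambda>s. \<sigma> / \<rho>) has_integral (t - a) * (\<sigma> / \<rho>)) {a..t}"
      using has_integral_const_real[of "\<sigma> / \<rho>" a t] t by simp
    \<comment> \<open>The value of \<open>u\<close> at \<open>t\<close> is unknown when
      \<open>t = b\<close>; a single point does not affect the integral.\<close>
    then have "((\<lambda>s. u s / \<rho>) has_integral (t - a) * (\<sigma> / \<rho>)) {a..t}"
      by (rule has_integral_spike_finite[of "{t}", rotated 2]) (use u t in auto)
    ultimately have "(\<theta> t - \<theta> 0) - (\<theta> a - \<theta> 0) = (t - a) * (\<sigma> / \<rho>)"
      by (rule has_integral_unique)
    then show ?thesis
      by (simp add: algebra_simps)
  qed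
  show "\<theta> b = \<theta> a + \<sigma> * (b - a) / \<rho>"
    using ab by (intro \<theta>) simp
  have d\<theta>: "(\<theta> has_real_derivative \<sigma> / \<rho>) (at t within {a..b})" if t: "t \<in> {a..b}" for t
  proof -
    have "((\<lambda>t. \<theta> a + \<sigma> * (t - a) / \<rho>) has_real_derivative \<sigma> / \<rho>) (at t within {a..b})"
      using \<open>\<rho> > 0\<close> by (auto intro!: derivative_eq_intros)
    then show ?thesis
      by (rule has_field_derivative_transform_within[where d = 1]) (use t in \<open>simp_all flip: \<theta>\<close>)
  qed
  have "((\<lambda>s. cos (\<theta> s)) has_integral ((x b - x 0) - (x a - x 0))) {a..b}"
    by (rule has_integral_diff_interval[OF integrals(1) integrals(1)]) (use ab in auto)
  moreover have "((\<lambda>s. cos (\<theta> s)) has_integral (\<sigma> * \<rho> * sin (\<theta> b) - \<sigma> * \<rho> * sin (\<theta> a))) {a..b}"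
    using ab \<open>\<rho> > 0\<close> \<sigma> d\<theta>
    by (intro fundamental_theorem_of_calculus)
       (auto intro!: derivative_eq_intros simp flip: has_real_derivative_iff_has_vector_derivative)
  ultimately have "(x b - x 0) - (x a - x 0) = \<sigma> * \<rho> * sin (\<theta> b) - \<sigma> * \<rho> * sin (\<theta> a)"
    by (rule has_integral_unique)
  then show "x b = x a + \<sigma> * \<rho> * (sin (\<theta> b) - sin (\<theta> a))"
    by (simp add: algebra_simps)
  have "((\<lambda>s. sin (\<theta> s)) has_integral ((y b - y 0) - (y a - y 0))) {a..b}"
    by (rule has_integral_diff_interval[OF integrals(2) integrals(2)]) (use ab in auto)
  moreover have "((\<lambda>s. sin (\<theta> s)) has_integral (- \<sigma> * \<rho> * cos (\<theta> b) - - \<sigma> * \<rho> * cos (\<theta> a))) {a..b}"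
    using ab \<open>\<rho> > 0\<close> \<sigma> d\<theta>
    by (intro fundamental_theorem_of_calculus)
       (auto intro!: derivative_eq_intros simp flip: has_real_derivative_iff_has_vector_derivative)
  ultimately have "(y b - y 0) - (y a - y 0) = - \<sigma> * \<rho> * cos (\<theta> b) - - \<sigma> * \<rho> * cos (\<theta> a)"
    by (rule has_integral_unique)
  then show "y b = y a - \<sigma> * \<rho> * (cos (\<theta> b) - cos (\<theta> a))"
    by (simp add: algebra_simps)
qed

lemma CCC_endpoint:
  assumes traj: "dubins_trajectory \<rho> T u x y \<theta>" and CCC: "CCC_type \<sigma> \<rho> \<alpha> \<beta> \<gamma> T u"
    and pos: "\<rho> > 0" "\<alpha> \<ge> 0" "\<beta> \<ge> 0" "\<gamma> \<ge> 0" and \<sigma>: "\<sigma> = 1 \<or> \<sigma> = - 1"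
  shows "\<theta> T = pi / 2 + \<sigma> * (\<alpha> - \<beta> + \<gamma>)"
    and "x T = \<sigma> * \<rho> * (sin (\<theta> T) - 1) + 4 * \<rho> * sin (\<beta> / 2) * cos (pi / 2 + \<sigma> * (\<alpha> - \<beta> / 2))"
    and "y T = - \<sigma> * \<rho> * cos (\<theta> T) + 4 * \<rho> * sin (\<beta> / 2) * sin (pi / 2 + \<sigma> * (\<alpha> - \<beta> / 2))"
proof -
  define a b where "a = \<rho> * \<alpha>" and "b = \<rho> * (\<alpha> + \<beta>)"
  have T: "T = \<rho> * (\<alpha> + \<beta> + \<gamma>)"
    and u: "\<forall>t\<in>{0..<a}. u t = \<sigma>" "\<forall>t\<in>{a..<b}. u t = - \<sigma>" "\<forall>t\<in>{b..<T}. u t = \<sigma>"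
    using CCC by (auto simp: CCC_type_def a_def b_def)
  have ord: "0 \<le> a" "a \<le> b" "b \<le> T" "a \<le> T" "0 \<le> b" "0 \<le> (0::real)" "T \<le> T"
    using pos by (auto simp: a_def b_def T mult_left_mono)
  have \<sigma>\<sigma>: "\<sigma> * \<sigma> = 1" "- \<sigma> * - \<sigma> = 1"
    using \<sigma> by auto
  note arc1 = dubins_arc[OF traj ord(6,1,4) u(1) \<sigma>\<sigma>(1) \<open>\<rho> > 0\<close>]
  note arc2 = dubins_arc[OF traj ord(1,2,3) u(2) \<sigma>\<sigma>(2) \<open>\<rho> > 0\<close>]
  note arc3 = dubins_arc[OF traj ord(5,3,7) u(3) \<sigma>\<sigma>(1) \<open>\<rho> > 0\<close>]
  have init: "x 0 = 0" "y 0 = 0" "\<theta> 0 = pi / 2"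
    using traj by (auto simp: dubins_trajectory_def)
  have \<theta>a: "\<theta> a = pi / 2 + \<sigma> * \<alpha>"
    using arc1(1) init pos by (simp add: a_def)
  have \<theta>b: "\<theta> b = pi / 2 + \<sigma> * (\<alpha> - \<beta>)"
    using arc2(1) pos unfolding \<theta>a by (simp add: a_def b_def field_simps)
  show "\<theta> T = pi / 2 + \<sigma> * (\<alpha> - \<beta> + \<gamma>)"
    using arc3(1) pos unfolding \<theta>b by (simp add: b_def T field_simps)
  \<comment> \<open>The half-sum is the heading halfway along the middle arc, which is the direction
    of its chord; the half-difference is half the angle that arc subtends, up to sign.\<close>
  have mid: "(\<theta> a + \<theta> b) / 2 = pi / 2 + \<sigma> * (\<alpha> - \<beta> / 2)" "(\<theta> a - \<theta> b) / 2 = \<sigma> * (\<beta> / 2)"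
    unfolding \<theta>a \<theta>b by (auto simp: field_simps)
  \<comment> \<open>The control changes sign at both switching times, so the terms at
    \<open>a\<close> and \<open>b\<close> double instead of cancelling, while the two end headings
    occur once.\<close>
  have "x T = \<sigma> * \<rho> * (sin (\<theta> T) - 1) + 2 * \<sigma> * \<rho> * (sin (\<theta> a) - sin (\<theta> b))"
    unfolding arc3(2) arc2(2) arc1(2) init by (simp add: algebra_simps)
  also have "sin (\<theta> a) - sin (\<theta> b) = 2 * sin (\<sigma> * (\<beta> / 2)) * cos (pi / 2 + \<sigma> * (\<alpha> - \<beta> / 2))"
    by (simp only: sin_diff_sin mid)
  finally show "x T = \<sigma> * \<rho> * (sin (\<theta> T) - 1) + 4 * \<rho> * sin (\<beta> / 2) * cos (pi / 2 + \<sigma> * (\<alpha> - \<beta> / 2))"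
    using \<sigma> by auto
  have "y T = - \<sigma> * \<rho> * cos (\<theta> T) + 2 * \<sigma> * \<rho> * (cos (\<theta> b) - cos (\<theta> a))"
    unfolding arc3(3) arc2(3) arc1(3) init by (simp add: algebra_simps)
  also have "cos (\<theta> b) - cos (\<theta> a) = 2 * sin (pi / 2 + \<sigma> * (\<alpha> - \<beta> / 2)) * sin (\<sigma> * (\<beta> / 2))"
    using cos_diff_cos[of "\<theta> b" "\<theta> a"] by (simp only: add.commute[of "\<theta> b"] mid)
  finally show "y T = - \<sigma> * \<rho> * cos (\<theta> T) + 4 * \<rho> * sin (\<beta> / 2) * sin (pi / 2 + \<sigma> * (\<alpha> - \<beta> / 2))"
    using \<sigma> by auto
qed

lemma angle_eq_of_mod_2pi:
  fixes \<phi> \<psi> :: real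
  assumes "\<phi> \<in> {0..<2 * pi}" "\<psi> \<in> {0..<2 * pi}" "\<phi> = \<psi> + 2 * of_int k * pi"
  shows "\<phi> = \<psi>"
proof -
  have "\<bar>of_int k * (2 * pi)\<bar> < 1 * (2 * pi)"
    using assms by auto
  then have "\<bar>real_of_int k\<bar> < 1"
    by (simp add: abs_mult)
  then have "k = 0"
    by linarith
  then show ?thesis
    using assms(3) by simp
qed

text \<open>Equates the endpoint of the path with the target, displaced by the wind over the flight
  time \<rho>(\<alpha> + \<beta> + \<gamma>). The integer \<open>n\<close> bringing the final
  heading into [0, 2\<pi>) replaces the unknown number of turns in the terminal condition.\<close>

lemma CCC_steering:
  assumes steers: "steers_to_target \<rho> w\<^sub>x w\<^sub>y X\<^sub>T Y\<^sub>T \<theta>\<^sub>f T u" and CCC: "CCC_type \<sigma> \<rho> \<alpha> \<beta> \<gamma> T u"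
    and pos: "\<rho> > 0" "\<alpha> \<ge> 0" "\<beta> \<ge> 0" "\<gamma> \<ge> 0" and \<sigma>: "\<sigma> = 1 \<or> \<sigma> = - 1"
    and \<theta>\<^sub>f: "\<theta>\<^sub>f \<in> {0..<2 * pi}"
    and n: "pi / 2 + \<sigma> * (\<alpha> - \<beta> + \<gamma>) + 2 * of_int n * pi \<in> {0..<2 * pi}"
  shows "pi / 2 + \<sigma> * (\<alpha> - \<beta> + \<gamma>) + 2 * of_int n * pi = \<theta>\<^sub>f"
    and "X\<^sub>T - \<rho> * (\<alpha> + \<beta> + \<gamma>) * w\<^sub>x - \<sigma> * \<rho> * (sin \<theta>\<^sub>f - 1)
      = 4 * \<rho> * sin (\<beta> / 2) * cos (pi / 2 + \<sigma> * (\<alpha> - \<beta> / 2))"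
    and "Y\<^sub>T - \<rho> * (\<alpha> + \<beta> + \<gamma>) * w\<^sub>y + \<sigma> * \<rho> * cos \<theta>\<^sub>f
      = 4 * \<rho> * sin (\<beta> / 2) * sin (pi / 2 + \<sigma> * (\<alpha> - \<beta> / 2))"
proof -
  obtain x y \<theta> and k :: int where traj: "dubins_trajectory \<rho> T u x y \<theta>"
    and target: "x T = X\<^sub>T - T * w\<^sub>x" "y T = Y\<^sub>T - T * w\<^sub>y" and k: "\<theta> T = \<theta>\<^sub>f + 2 * of_int k * pi"
    using steers by (auto simp: steers_to_target_def)
  note endpoint = CCC_endpoint[OF traj CCC pos \<sigma>]
  have T: "T = \<rho> * (\<alpha> + \<beta> + \<gamma>)"
    using CCC by (simp add: CCC_type_def)
  \<comment> \<open>Both sides lie in [0, 2\<pi>) and differ by \<open>k + n\<close> full turns,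
    hence they agree.\<close>
  show "pi / 2 + \<sigma> * (\<alpha> - \<beta> + \<gamma>) + 2 * of_int n * pi = \<theta>\<^sub>f"
    using endpoint(1) k by (intro angle_eq_of_mod_2pi[OF n \<theta>\<^sub>f, of "k + n"]) (simp add: algebra_simps)
  have "sin (\<theta> T) = sin \<theta>\<^sub>f" "cos (\<theta> T) = cos \<theta>\<^sub>f"
    using sin.plus_of_int[of \<theta>\<^sub>f k] cos.plus_of_int[of \<theta>\<^sub>f k] by (simp_all add: k mult_ac)
  then show "X\<^sub>T - \<rho> * (\<alpha> + \<beta> + \<gamma>) * w\<^sub>x - \<sigma> * \<rho> * (sin \<theta>\<^sub>f - 1)
      = 4 * \<rho> * sin (\<beta> / 2) * cos (pi / 2 + \<sigma> * (\<alpha> - \<beta> / 2))"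
    and "Y\<^sub>T - \<rho> * (\<alpha> + \<beta> + \<gamma>) * w\<^sub>y + \<sigma> * \<rho> * cos \<theta>\<^sub>f
      = 4 * \<rho> * sin (\<beta> / 2) * sin (pi / 2 + \<sigma> * (\<alpha> - \<beta> / 2))"
    using endpoint(2,3) target T by simp_all
qed

text \<open>Here (\<open>p\<close>, \<open>q\<close>) is the wind for RLR and its negative for LRL.
  Squared hypotheses suit both types, since each matches one of the two chord components only up to
  sign.\<close>

lemma chord_quadratic:
  fixes A B :: real
  assumes "(A + 2 * \<rho> * \<beta> * p)\<^sup>2 = (4 * \<rho> * sin (\<beta> / 2) * cos m)\<^sup>2"
    and "(B - 2 * \<rho> * \<beta> * q)\<^sup>2 = (4 * \<rho> * sin (\<beta> / 2) * sin m)\<^sup>2"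
  shows "4 * \<rho>\<^sup>2 * (p\<^sup>2 + q\<^sup>2) * \<beta>\<^sup>2 + 4 * \<rho> * (A * p - B * q) * \<beta> + 8 * \<rho>\<^sup>2 * cos \<beta>
    + (A\<^sup>2 + B\<^sup>2 - 8 * \<rho>\<^sup>2) = 0"
proof -
  have "(A + 2 * \<rho> * \<beta> * p)\<^sup>2 + (B - 2 * \<rho> * \<beta> * q)\<^sup>2
      = 16 * \<rho>\<^sup>2 * (sin (\<beta> / 2))\<^sup>2 * ((cos m)\<^sup>2 + (sin m)\<^sup>2)"
    unfolding assms unfolding distrib_left by (simp add: power_mult_distrib)
  also have "\<dots> = 8 * \<rho>\<^sup>2 * (1 - cos \<beta>)"
    using cos_double_sin[of "\<beta> / 2"] by simp
  finally show ?thesis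
    by (simp add: power2_eq_square algebra_simps)
qed

text \<open>The signs of the wind terms are those forced by a target at
  \<open>X\<^sub>T - T * w\<^sub>x\<close>, \<open>Y\<^sub>T - T * w\<^sub>y\<close>. The range
  condition determines the integer \<open>n\<close>, whatever its sign. The quotients are asserted
  only for \<beta> different from 0, where their denominators do not vanish.\<close>

theorem lemma2:
  fixes \<rho> w\<^sub>x w\<^sub>y X\<^sub>T Y\<^sub>T \<theta>\<^sub>f T \<alpha> \<beta> \<gamma> :: real and u :: "real \<Rightarrow> real"
  assumes "\<rho> > 0" and "w\<^sub>x\<^sup>2 + w\<^sub>y\<^sup>2 < 1" and "\<theta>\<^sub>f \<in> {0..<2 * pi}"
    and "\<alpha> \<in> {0..<2 * pi}" and "\<beta> \<in> {0..<2 * pi}" and "\<gamma> \<in> {0..<2 * pi}"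
    and "min_time_solution \<rho> w\<^sub>x w\<^sub>y X\<^sub>T Y\<^sub>T \<theta>\<^sub>f T u"
  shows
    "(RLR_type \<rho> \<alpha> \<beta> \<gamma> T u \<longrightarrow>
       (\<forall>n::int. pi / 2 - \<alpha> + \<beta> - \<gamma> + 2 * of_int n * pi \<in> {0..<2 * pi} \<longrightarrow>
         (let M = - X\<^sub>T + \<rho> * w\<^sub>x * (pi / 2 - \<theta>\<^sub>f + 2 * of_int n * pi) - \<rho> * sin \<theta>\<^sub>f + \<rho>;
              N = Y\<^sub>T - \<rho> * w\<^sub>y * (pi / 2 - \<theta>\<^sub>f + 2 * of_int n * pi) - \<rho> * cos \<theta>\<^sub>f;
              c\<^sub>1 = 4 * \<rho>\<^sup>2 * (w\<^sub>x\<^sup>2 + w\<^sub>y\<^sup>2);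
              c\<^sub>2 = 4 * \<rho> * (M * w\<^sub>x - N * w\<^sub>y);
              c\<^sub>3 = 8 * \<rho>\<^sup>2;
              c\<^sub>4 = M\<^sup>2 + N\<^sup>2 - 8 * \<rho>\<^sup>2;
              q = (- (X\<^sub>T - \<rho> * w\<^sub>x * (pi / 2 - \<theta>\<^sub>f + 2 * \<beta> + 2 * of_int n * pi)) - \<rho> * sin \<theta>\<^sub>f + \<rho>)
                    / (4 * \<rho> * sin (- \<beta> / 2))
          in c\<^sub>1 * \<beta>\<^sup>2 + c\<^sub>2 * \<beta> + c\<^sub>3 * cos \<beta> + c\<^sub>4 = 0 \<and>
             (\<beta> \<noteq> 0 \<longrightarrow> cos (- \<alpha> + \<beta> / 2 + pi / 2) = q \<and> cos (\<gamma> - \<beta> / 2 + \<theta>\<^sub>f) = q)))) \<and>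
     (LRL_type \<rho> \<alpha> \<beta> \<gamma> T u \<longrightarrow>
       (\<forall>n::int. pi / 2 + \<alpha> - \<beta> + \<gamma> + 2 * of_int n * pi \<in> {0..<2 * pi} \<longrightarrow>
         (let P = X\<^sub>T - \<rho> * w\<^sub>x * (\<theta>\<^sub>f - pi / 2 - 2 * of_int n * pi) - \<rho> * sin \<theta>\<^sub>f + \<rho>;
              Q = - Y\<^sub>T + \<rho> * w\<^sub>y * (\<theta>\<^sub>f - pi / 2 - 2 * of_int n * pi) - \<rho> * cos \<theta>\<^sub>f;
              d\<^sub>1 = 4 * \<rho>\<^sup>2 * (w\<^sub>x\<^sup>2 + w\<^sub>y\<^sup>2);
              d\<^sub>2 = - 4 * \<rho> * (P * w\<^sub>x - Q * w\<^sub>y);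
              d\<^sub>3 = 8 * \<rho>\<^sup>2;
              d\<^sub>4 = P\<^sup>2 + Q\<^sup>2 - 8 * \<rho>\<^sup>2;
              q = (X\<^sub>T - \<rho> * w\<^sub>x * (\<theta>\<^sub>f + 2 * \<beta> - pi / 2 - 2 * of_int n * pi) - \<rho> * sin \<theta>\<^sub>f + \<rho>)
                    / (4 * \<rho> * sin (\<beta> / 2))
          in d\<^sub>1 * \<beta>\<^sup>2 + d\<^sub>2 * \<beta> + d\<^sub>3 * cos \<beta> + d\<^sub>4 = 0 \<and>
             (\<beta> \<noteq> 0 \<longrightarrow> cos (\<alpha> - \<beta> / 2 + pi / 2) = q \<and> cos (- \<gamma> + \<beta> / 2 + \<theta>\<^sub>f) = q))))"
proof -
  have steers: "steers_to_target \<rho> w\<^sub>x w\<^sub>y X\<^sub>T Y\<^sub>T \<theta>\<^sub>f T u"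
    using assms(7) by (simp add: min_time_solution_def)
  have nonneg: "\<alpha> \<ge> 0" "\<beta> \<ge> 0" "\<gamma> \<ge> 0"
    using assms(4-6) by auto
  \<comment> \<open>Here 0 < \<beta>/2 < \<pi>, where the sine is positive.\<close>
  have denom: "4 * \<rho> * sin (\<beta> / 2) \<noteq> 0" if "\<beta> \<noteq> 0"
    using that assms(1,5) sin_gt_zero[of "\<beta> / 2"] by auto
  show ?thesis
  proof (intro conjI impI allI, goal_cases)
    case RLR: (1 n)
    define m where "m = pi / 2 + - 1 * (\<alpha> - \<beta> / 2)"
    have n: "pi / 2 + - 1 * (\<alpha> - \<beta> + \<gamma>) + 2 * of_int n * pi \<in> {0..<2 * pi}"
      using RLR(2) by (simp add: algebra_simps)
    note CCC = CCC_steering[OF steers RLR(1)[unfolded RLR_type_def] assms(1) nonneg disjI2[OF refl] assms(3) n,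
        folded m_def]
    \<comment> \<open>The heading condition makes \<alpha> - \<beta> + \<gamma> explicit in
      \<open>\<theta>\<^sub>f\<close> and \<open>n\<close>. Adding 2\<beta> gives the flight time
      divided by \<rho>, so \<beta> is the only unknown left in the wind terms.\<close>
    have \<phi>: "pi / 2 - \<theta>\<^sub>f + 2 * of_int n * pi = \<alpha> - \<beta> + \<gamma>"
      using CCC(1) by simp
    have \<phi>': "pi / 2 - \<theta>\<^sub>f + 2 * \<beta> + 2 * of_int n * pi = \<alpha> + \<beta> + \<gamma>"
      using \<phi> by simp
    have m1: "- \<alpha> + \<beta> / 2 + pi / 2 = m"
      by (simp add: m_def)
    \<comment> \<open>The direction \<open>m\<close>, now measured back from the final heading, is
      recovered up to \<open>n\<close> full turns; hence both cosine formulas have the same value,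
      and \<open>conj_absorb\<close> merges them.\<close>
    have "\<gamma> - \<beta> / 2 + \<theta>\<^sub>f = m + of_int n * (2 * pi)"
      using CCC(1) by (simp add: m_def algebra_simps)
    then have m2: "cos (\<gamma> - \<beta> / 2 + \<theta>\<^sub>f) = cos m"
      using cos.plus_of_int[of m n] by simp
    show ?case
      unfolding Let_def \<phi> \<phi>' m1 m2 conj_absorb
    proof (intro conjI impI chord_quadratic[where m = m])
      \<comment> \<open>For RLR the horizontal equation appears negated and the vertical one as it
        stands.\<close>
      show "(- X\<^sub>T + \<rho> * w\<^sub>x * (\<alpha> - \<beta> + \<gamma>) - \<rho> * sin \<theta>\<^sub>f + \<rho> + 2 * \<rho> * \<beta> * w\<^sub>x)\<^sup>2
          = (4 * \<rho> * sin (\<beta> / 2) * cos m)\<^sup>2"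
        unfolding power2_eq_iff using CCC(2) by (intro disjI2) (simp add: algebra_simps)
      show "(Y\<^sub>T - \<rho> * w\<^sub>y * (\<alpha> - \<beta> + \<gamma>) - \<rho> * cos \<theta>\<^sub>f - 2 * \<rho> * \<beta> * w\<^sub>y)\<^sup>2
          = (4 * \<rho> * sin (\<beta> / 2) * sin m)\<^sup>2"
        unfolding power2_eq_iff using CCC(3) by (intro disjI1) (simp add: algebra_simps)
      assume "\<beta> \<noteq> 0"
      \<comment> \<open>The negated numerator is compensated by sin(-\<beta>/2) =
        -sin(\<beta>/2).\<close>
      then show "cos m = (- (X\<^sub>T - \<rho> * w\<^sub>x * (\<alpha> + \<beta> + \<gamma>)) - \<rho> * sin \<theta>\<^sub>f + \<rho>)
          / (4 * \<rho> * sin (- \<beta> / 2))"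
        using denom CCC(2) by (simp add: eq_divide_eq algebra_simps)
    qed
  next
    case LRL: (2 n)
    define m where "m = pi / 2 + 1 * (\<alpha> - \<beta> / 2)"
    have n: "pi / 2 + 1 * (\<alpha> - \<beta> + \<gamma>) + 2 * of_int n * pi \<in> {0..<2 * pi}"
      using LRL(2) by (simp add: algebra_simps)
    note CCC = CCC_steering[OF steers LRL(1)[unfolded LRL_type_def] assms(1) nonneg disjI1[OF refl] assms(3) n,
        folded m_def]
    have \<phi>: "\<theta>\<^sub>f - pi / 2 - 2 * of_int n * pi = \<alpha> - \<beta> + \<gamma>"
      using CCC(1) by simp
    have \<phi>': "\<theta>\<^sub>f + 2 * \<beta> - pi / 2 - 2 * of_int n * pi = \<alpha> + \<beta> + \<gamma>"
      using \<phi> by simp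
    have m1: "\<alpha> - \<beta> / 2 + pi / 2 = m"
      by (simp add: m_def)
    have "- \<gamma> + \<beta> / 2 + \<theta>\<^sub>f = m + of_int n * (2 * pi)"
      using CCC(1) by (simp add: m_def algebra_simps)
    then have m2: "cos (- \<gamma> + \<beta> / 2 + \<theta>\<^sub>f) = cos m"
      using cos.plus_of_int[of m n] by simp
    \<comment> \<open>Applying the chord equation to the reversed wind leaves the \<beta>-squared
      coefficient unchanged and produces the minus sign in \<open>d\<^sub>2\<close>. Now the
      vertical equation is the negated one.\<close>
    have quadratic: "4 * \<rho>\<^sup>2 * ((- w\<^sub>x)\<^sup>2 + (- w\<^sub>y)\<^sup>2) * \<beta>\<^sup>2 + 4 * \<rho> * (P * - w\<^sub>x - Q * - w\<^sub>y) * \<beta>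
        + 8 * \<rho>\<^sup>2 * cos \<beta> + (P\<^sup>2 + Q\<^sup>2 - 8 * \<rho>\<^sup>2) = 0"
      if P: "P = X\<^sub>T - \<rho> * w\<^sub>x * (\<alpha> - \<beta> + \<gamma>) - \<rho> * sin \<theta>\<^sub>f + \<rho>"
        and Q: "Q = - Y\<^sub>T + \<rho> * w\<^sub>y * (\<alpha> - \<beta> + \<gamma>) - \<rho> * cos \<theta>\<^sub>f" for P Q
    proof (rule chord_quadratic[where m = m])
      show "(P + 2 * \<rho> * \<beta> * - w\<^sub>x)\<^sup>2 = (4 * \<rho> * sin (\<beta> / 2) * cos m)\<^sup>2"
        unfolding P power2_eq_iff using CCC(2) by (intro disjI1) (simp add: algebra_simps)
      show "(Q - 2 * \<rho> * \<beta> * - w\<^sub>y)\<^sup>2 = (4 * \<rho> * sin (\<beta> / 2) * sin m)\<^sup>2"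
        unfolding Q power2_eq_iff using CCC(3) by (intro disjI2) (simp add: algebra_simps)
    qed
    show ?case
      unfolding Let_def \<phi> \<phi>' m1 m2 conj_absorb
    proof (intro conjI impI, goal_cases)
      case 1
      show ?case
        using quadratic[OF refl refl] by (simp add: algebra_simps)
    next
      case 2
      then show ?case
        using denom CCC(2) by (simp add: eq_divide_eq algebra_simps)
    qed
  qed
qed

end
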